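(* Let $N\ge 1$ and let $\mathcal I$ be a (possibly unbounded) real interval. On the set $\mathbb W(N,\mathcal I)$ of $N\times N$ weight matrices on $\mathcal I$, define $W\sim\widetilde W$ if and only if $\widetilde W$ is a Darboux transformation of $W$. Then $\sim$ is an equivalence relation on $\mathbb W(N,\mathcal I)$.
   Context: A weight matrix of size $N$ on an interval $\mathcal I=(x_0,x_1)$ is a smooth function $W:\mathcal I\to \operatorname{Mat}_N(\mathbb C)$, positive definite almost everywhere, with finite moments of all orders. Standing assumption: for each $n\ge 0$ the derivative $W^{(n)}(x)$ decreases exponentially at infinity and there is a scalar polynomial $p_n(x)$ such that $W^{(n)}(x)p_n(x)$ has finite moments. The monic orthogonal polynomials $P_n$ of $W$ are the unique sequence in $\operatorname{Mat}_N(\mathbb C)[x]$ with $P_n$ monic of degree $n$ (leading coefficient $I$) and $\int_{x_0}^{x_1} P_n(x)W(x)P_m(x)^*\,dx=0$ for $n\ne m$. Differential operators $D=\sum_{j}\partial^jF_j(x)$, $\partial=\frac{d}{dx}$, act on the right on matrix-valued functions: $P(x)\cdot D=\sum_j \partial^j(P)(x)F_j(x)$; the product satisfies $P\cdot(D_1D_2)=(P\cdot D_1)\cdot D_2$. $\operatorname{Mat}_N(\Omega[x])$ is the algebra of such operators with all $F_j\in\operatorname{Mat}_N(\mathbb C)[x]$. $\mathcal D(W)$ is the algebra of all $D\in\operatorname{Mat}_N(\Omega[x])$ such that for every $n\ge0$ there is $\Lambda_n(D)\in\operatorname{Mat}_N(\mathbb C)$ with $P_n\cdot D=\Lambda_n(D)P_n$.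 An operator $\mathcal V\in\operatorname{Mat}_N(\Omega[x])$ is degree-preserving if $\deg(P\cdot\mathcal V)=\deg P$ for all $P\in\operatorname{Mat}_N(\mathbb C)[x]$. Darboux transformation: for weight matrices $W,\widetilde W$ of size $N$ on the same interval with monic orthogonal polynomials $P_n,\widetilde P_n$, $\widetilde W$ is a Darboux transformation of $W$ if there is $D\in\mathcal D(W)$ that factors as $D=\mathcal V\mathcal N$ with $\mathcal V,\mathcal N\in\operatorname{Mat}_N(\Omega[x])$ degree-preserving and such that $P_n\cdot\mathcal V=A_n\widetilde P_n$ for all $n\in\mathbb N_0$, for some matrices $A_n\in\operatorname{Mat}_N(\mathbb C)$. *)

theory Defs
  imports "HOL-Analysis.Analysis" "HOL-Computational_Algebra.Polynomial"
begin

text \<open>The size \<open>N \<ge> 1\<close> of the matrices is the cardinality of the finite index type \<open>'n\<close>, and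
  \<open>Mat\<^sub>N(\<complex>)\<close> is \<open>complex^'n^'n\<close>. Products of matrices are always \<open>**\<close>; the overloaded \<open>*\<close> of
  the type of vectors is the entrywise product and is never used.\<close>

definition conj_transpose :: "complex^'n^'m \<Rightarrow> complex^'m^'n" where
  "conj_transpose A = (\<chi> i j. cnj (A $ j $ i))"

definition pos_definite :: "complex^'n^'n \<Rightarrow> bool" where
  "pos_definite A \<longleftrightarrow> conj_transpose A = A \<and>
     (\<forall>v. v \<noteq> 0 \<longrightarrow> 0 < Re (\<Sum>i\<in>UNIV. \<Sum>j\<in>UNIV. cnj (v $ i) * A $ i $ j * v $ j))"


section \<open>Weight matrices\<close>

text \<open>The interval \<open>\<I> = (a, b)\<close> is \<open>einterval a b\<close> with endpoints in the extended reals.\<close>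

definition has_finite_moments :: "ereal \<Rightarrow> ereal \<Rightarrow> (real \<Rightarrow> complex^'n^'n) \<Rightarrow> bool" where
  "has_finite_moments a b F \<longleftrightarrow>
     (\<forall>k::nat. set_integrable lborel (einterval a b) (\<lambda>x. x ^ k *\<^sub>R F x))"

definition nth_deriv :: "nat \<Rightarrow> (real \<Rightarrow> 'a::real_normed_vector) \<Rightarrow> real \<Rightarrow> 'a" where
  "nth_deriv n F = ((\<lambda>G x. vector_derivative G (at x)) ^^ n) F"

definition smooth_matrix_fun :: "ereal \<Rightarrow> ereal \<Rightarrow> (real \<Rightarrow> complex^'n^'n) \<Rightarrow> bool" where
  "smooth_matrix_fun a b F \<longleftrightarrow> (\<forall>n. \<forall>x\<in>einterval a b. nth_deriv n F differentiable (at x))"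

text \<open>The bound only concerns points of the interval of large modulus, so it says something at
  each infinite endpoint, and nothing if the interval is bounded.\<close>

definition exp_decreasing :: "ereal \<Rightarrow> ereal \<Rightarrow> (real \<Rightarrow> complex^'n^'n) \<Rightarrow> bool" where
  "exp_decreasing a b F \<longleftrightarrow>
     (\<exists>c>0. \<exists>C R. \<forall>x\<in>einterval a b. \<bar>x\<bar> \<ge> R \<longrightarrow> norm (F x) \<le> C * exp (- c * \<bar>x\<bar>))"

text \<open>The set \<open>\<W>(N, (a, b))\<close>. A function with domain \<open>(a, b)\<close> is encoded as an element of
  \<open>extensional\<close>. The last condition is the standing assumption on the derivatives, where the
  scalar polynomial \<open>p\<close> has to be nonzero, since for \<open>p = 0\<close> nothing would be required.\<close>

definition weight_matrices :: "ereal \<Rightarrow> ereal \<Rightarrow> (real \<Rightarrow> complex^'n^'n) set" where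
  "weight_matrices a b = {W \<in> extensional (einterval a b).
     smooth_matrix_fun a b W \<and>
     (AE x in lborel. x \<in> einterval a b \<longrightarrow> pos_definite (W x)) \<and>
     has_finite_moments a b W \<and>
     (\<forall>n. exp_decreasing a b (nth_deriv n W) \<and>
          (\<exists>p::complex poly. p \<noteq> 0 \<and>
             has_finite_moments a b (\<lambda>x. mat (poly p (of_real x)) ** nth_deriv n W x)))}"


section \<open>Matrix polynomials and monic orthogonal polynomials\<close>

text \<open>\<open>Mat\<^sub>N(\<complex>)[x]\<close> is represented as \<open>Mat\<^sub>N(\<complex>[x])\<close>.\<close>

type_synonym 'n mpoly = "complex poly^'n^'n"

definition mpoly_const :: "complex^'n^'n \<Rightarrow> 'n mpoly" where
  "mpoly_const A = (\<chi> i j. [:A $ i $ j:])"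

definition mpoly_coeff :: "'n::finite mpoly \<Rightarrow> nat \<Rightarrow> complex^'n^'n" where
  "mpoly_coeff P k = (\<chi> i j. coeff (P $ i $ j) k)"

definition mpoly_eval :: "'n::finite mpoly \<Rightarrow> real \<Rightarrow> complex^'n^'n" where
  "mpoly_eval P x = (\<chi> i j. poly (P $ i $ j) (of_real x))"

definition mpoly_deriv :: "'n::finite mpoly \<Rightarrow> 'n mpoly" where
  "mpoly_deriv P = (\<chi> i j. pderiv (P $ i $ j))"

text \<open>The zero polynomial has degree \<open>-\<infinity>\<close>. With degree \<open>0\<close> instead, a degree-preserving operator
  could annihilate nonzero constants.\<close>

definition mpoly_degree :: "'n::finite mpoly \<Rightarrow> ereal" where
  "mpoly_degree P =
     (if P = 0 then -\<infinity> else ereal (real (Max {k. mpoly_coeff P k \<noteq> 0})))"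

definition is_monic_OPs ::
    "ereal \<Rightarrow> ereal \<Rightarrow> (real \<Rightarrow> complex^'n^'n) \<Rightarrow> (nat \<Rightarrow> 'n mpoly) \<Rightarrow> bool" where
  "is_monic_OPs a b W P \<longleftrightarrow>
     (\<forall>n. mpoly_degree (P n) = ereal (real n) \<and> mpoly_coeff (P n) n = mat 1) \<and>
     (\<forall>n m. n \<noteq> m \<longrightarrow>
        (LINT x:einterval a b|lborel.
           mpoly_eval (P n) x ** W x ** conj_transpose (mpoly_eval (P m) x)) = 0)"

definition monic_OPs :: "ereal \<Rightarrow> ereal \<Rightarrow> (real \<Rightarrow> complex^'n^'n) \<Rightarrow> nat \<Rightarrow> 'n mpoly" where
  "monic_OPs a b W = (THE P. is_monic_OPs a b W P)"


section \<open>Differential operators\<close>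

text \<open>The operator \<open>\<Sum>\<^sub>j \<partial>\<^sup>j F\<^sub>j(x)\<close> is represented by the finitely supported sequence of the \<open>F\<^sub>j\<close>,
  as a polynomial in \<open>\<partial>\<close>. Its multiplication is \<open>op_mult\<close>, not the one of the type \<open>poly\<close>.\<close>

type_synonym 'n diff_op = "'n mpoly poly"

definition op_act :: "'n::finite mpoly \<Rightarrow> 'n diff_op \<Rightarrow> 'n mpoly" where
  "op_act P D = (\<Sum>j\<le>degree D. (mpoly_deriv ^^ j) P ** coeff D j)"

text \<open>By the Leibniz rule,
  \<open>(\<partial>\<^sup>i F) (\<partial>\<^sup>j G) = \<Sum>\<^sub>k (j choose k) \<partial>\<^sup>i\<^sup>+\<^sup>k (\<partial>\<^sup>j\<^sup>-\<^sup>k(F) G)\<close>; see \<open>op_act_op_mult\<close> below.\<close>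

definition op_mult :: "'n::finite diff_op \<Rightarrow> 'n diff_op \<Rightarrow> 'n diff_op" where
  "op_mult D E = (\<Sum>i\<le>degree D. \<Sum>j\<le>degree E. \<Sum>k\<le>j.
     monom (mat (of_nat (j choose k)) **
            ((mpoly_deriv ^^ (j - k)) (coeff D i) ** coeff E j)) (i + k))"

definition degree_preserving :: "'n::finite diff_op \<Rightarrow> bool" where
  "degree_preserving V \<longleftrightarrow> (\<forall>P. mpoly_degree (op_act P V) = mpoly_degree P)"

text \<open>The algebra \<open>\<D>(W)\<close>.\<close>

definition weight_ops ::
    "ereal \<Rightarrow> ereal \<Rightarrow> (real \<Rightarrow> complex^'n^'n) \<Rightarrow> 'n diff_op set" where
  "weight_ops a b W =
     {D. \<forall>n. \<exists>\<Lambda>. op_act (monic_OPs a b W n) D = mpoly_const \<Lambda> ** monic_OPs a b W n}"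

definition is_Darboux_transformation ::
    "ereal \<Rightarrow> ereal \<Rightarrow> (real \<Rightarrow> complex^'n^'n) \<Rightarrow> (real \<Rightarrow> complex^'n^'n) \<Rightarrow> bool" where
  "is_Darboux_transformation a b W W' \<longleftrightarrow>
     (\<exists>D\<in>weight_ops a b W. \<exists>V N.
        D = op_mult V N \<and> degree_preserving V \<and> degree_preserving N \<and>
        (\<exists>A. \<forall>n. op_act (monic_OPs a b W n) V = mpoly_const (A n) ** monic_OPs a b W' n))"


section \<open>The product of operators is composition of the right actions\<close>

lemma matrix_mult_sum_right: "(\<Sum>i\<in>S. f i) ** B = (\<Sum>i\<in>S. f i ** B)"
  for f :: "'b \<Rightarrow> 'a::comm_semiring_1^'n^'m" and B :: "'a^'p^'n"
  by (simp add: vec_eq_iff matrix_matrix_mult_def sum_distrib_right sum.swap[of _ S UNIV])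

lemma matrix_mult_sum_left: "B ** (\<Sum>i\<in>S. f i) = (\<Sum>i\<in>S. B ** f i)"
  for f :: "'b \<Rightarrow> 'a::comm_semiring_1^'n^'m" and B :: "'a^'m^'p"
  by (simp add: vec_eq_iff matrix_matrix_mult_def sum_distrib_left sum.swap[of _ S UNIV])

lemma mat_mult_nth: "(mat c ** A) $ i $ j = c * A $ i $ j"
  for A :: "'a::comm_semiring_1^'n^'m"
  by (simp add: matrix_matrix_mult_def mat_def if_distrib if_distribR cong: if_cong)

lemma mat_mult_commute: "A ** (mat c ** B) = mat c ** (A ** B)"
  for A :: "'a::comm_semiring_1^'n^'m" and B :: "'a^'p^'n"
  by (simp add: vec_eq_iff mat_mult_nth)
     (simp add: matrix_matrix_mult_def mat_mult_nth sum_distrib_left algebra_simps mat_def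
        if_distrib if_distribR cong: if_cong)

lemma mpoly_deriv_add: "mpoly_deriv (P + Q) = mpoly_deriv P + mpoly_deriv Q"
  by (simp add: mpoly_deriv_def vec_eq_iff pderiv_add)

lemma mpoly_deriv_0: "mpoly_deriv 0 = 0"
  by (simp add: mpoly_deriv_def vec_eq_iff)

lemma mpoly_deriv_sum: "mpoly_deriv (\<Sum>i\<in>S. f i) = (\<Sum>i\<in>S. mpoly_deriv (f i))"
  by (induction S rule: infinite_finite_induct) (auto simp: mpoly_deriv_add mpoly_deriv_0)

lemma higher_mpoly_deriv_sum:
  "(mpoly_deriv ^^ n) (\<Sum>i\<in>S. f i) = (\<Sum>i\<in>S. (mpoly_deriv ^^ n) (f i))"
  by (induction n) (auto simp: mpoly_deriv_sum)

lemma pderiv_sum': "pderiv (\<Sum>i\<in>S. f i) = (\<Sum>i\<in>S. pderiv (f i))"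
  for f :: "'b \<Rightarrow> complex poly"
  using higher_pderiv_sum[of 1 f S] by simp

lemma mpoly_deriv_mult: "mpoly_deriv (P ** Q) = mpoly_deriv P ** Q + P ** mpoly_deriv Q"
  by (simp add: mpoly_deriv_def vec_eq_iff matrix_matrix_mult_def pderiv_sum' pderiv_mult
      sum.distrib algebra_simps)

lemma mpoly_deriv_scale: "mpoly_deriv (mat (of_nat c) ** P) = mat (of_nat c) ** mpoly_deriv P"
  by (simp add: vec_eq_iff mat_mult_nth) (simp add: mpoly_deriv_def mat_mult_nth pderiv_mult)

lemma higher_mpoly_deriv_mult:
  "(mpoly_deriv ^^ n) (P ** Q) =
     (\<Sum>k\<le>n. mat (of_nat (n choose k)) ** ((mpoly_deriv ^^ k) P ** (mpoly_deriv ^^ (n - k)) Q))"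
proof (induction n)
  case 0
  show ?case by simp
next
  case (Suc n)
  let ?p = "\<lambda>k. (mpoly_deriv ^^ k) P" and ?q = "\<lambda>k. (mpoly_deriv ^^ k) Q"
  let ?c = "\<lambda>m. mat (of_nat m) :: complex poly^'a^'a"
  have cadd: "?c (m + m') ** X = ?c m ** X + ?c m' ** X" for m m' and X :: "complex poly^'a^'a"
    by (simp add: vec_eq_iff mat_mult_nth algebra_simps)
  have c0: "mat 0 ** X = 0" for X :: "complex poly^'a^'a"
    by (simp add: vec_eq_iff mat_mult_nth)
  have "(mpoly_deriv ^^ Suc n) (P ** Q) =
      (\<Sum>k\<le>n. ?c (n choose k) ** (?p (Suc k) ** ?q (n - k))) +
      (\<Sum>k\<le>n. ?c (n choose k) ** (?p k ** ?q (Suc (n - k))))"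
    by (simp add: Suc mpoly_deriv_sum mpoly_deriv_scale)
       (simp add: mpoly_deriv_mult matrix_add_ldistrib sum.distrib)
  also have "(\<Sum>k\<le>n. ?c (n choose k) ** (?p k ** ?q (Suc (n - k)))) =
      (\<Sum>k\<le>Suc n. ?c (n choose k) ** (?p k ** ?q (Suc n - k)))"
    by (simp add: binomial_eq_0 c0 Suc_diff_le)
  also have "\<dots> = ?p 0 ** ?q (Suc n) +
      (\<Sum>k\<le>n. ?c (n choose Suc k) ** (?p (Suc k) ** ?q (n - k)))"
    by (simp add: sum.atMost_Suc_shift del: sum.atMost_Suc funpow.simps)
  also have "(\<Sum>k\<le>n. ?c (n choose k) ** (?p (Suc k) ** ?q (n - k))) + \<dots> =
      ?p 0 ** ?q (Suc n) +
      (\<Sum>k\<le>n. ?c (Suc n choose Suc k) ** (?p (Suc k) ** ?q (n - k)))"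
    by (simp only: binomial_Suc_Suc cadd sum.distrib) (simp only: add_ac)
  also have "\<dots> = (\<Sum>k\<le>Suc n. ?c (Suc n choose k) ** (?p k ** ?q (Suc n - k)))"
    by (simp add: sum.atMost_Suc_shift del: sum.atMost_Suc funpow.simps binomial_Suc_Suc)
  finally show ?case .
qed

lemma op_act_bound:
  assumes "degree D \<le> n"
  shows "op_act P D = (\<Sum>j\<le>n. (mpoly_deriv ^^ j) P ** coeff D j)"
  unfolding op_act_def
  by (rule sum.mono_neutral_left)
     (use assms in \<open>auto simp: coeff_eq_0 vec_eq_iff matrix_matrix_mult_def\<close>)

lemma op_act_add: "op_act P (D + E) = op_act P D + op_act P E"
proof -
  define n where "n = max (degree D) (degree E)"
  have "degree (D + E) \<le> n" "degree D \<le> n" "degree E \<le> n"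
    by (auto simp: n_def degree_add_le_max)
  then show ?thesis
    by (simp add: op_act_bound[of _ n] matrix_add_ldistrib sum.distrib)
qed

lemma op_act_0: "op_act P 0 = 0"
  by (simp add: op_act_def vec_eq_iff matrix_matrix_mult_def)

lemma op_act_sum: "op_act P (\<Sum>i\<in>S. f i) = (\<Sum>i\<in>S. op_act P (f i))"
  by (induction S rule: infinite_finite_induct) (auto simp: op_act_add op_act_0)

lemma op_act_monom: "op_act P (monom F m) = (mpoly_deriv ^^ m) P ** F"
proof -
  have "op_act P (monom F m) = (\<Sum>j\<le>m. (mpoly_deriv ^^ j) P ** coeff (monom F m) j)"
    by (rule op_act_bound) (rule degree_monom_le)
  also have "\<dots> = (\<Sum>j\<le>m. if j = m then (mpoly_deriv ^^ m) P ** F else 0)"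
    by (rule sum.cong) (auto simp: vec_eq_iff matrix_matrix_mult_def)
  finally show ?thesis by simp
qed

theorem op_act_op_mult: "op_act P (op_mult D E) = op_act (op_act P D) E"
proof -
  have "op_act (op_act P D) E =
      (\<Sum>j\<le>degree E. \<Sum>i\<le>degree D. (mpoly_deriv ^^ j) ((mpoly_deriv ^^ i) P ** coeff D i) ** coeff E j)"
    unfolding op_act_def[of _ E]
    by (simp add: op_act_def[of P D] higher_mpoly_deriv_sum matrix_mult_sum_right)
  also have "\<dots> = (\<Sum>i\<le>degree D. \<Sum>j\<le>degree E. 
       (mpoly_deriv ^^ j) ((mpoly_deriv ^^ i) P ** coeff D i) ** coeff E j)"
    by (rule sum.swap)
  also have "\<dots> = op_act P (op_mult D E)"
  proof -
    have "(mpoly_deriv ^^ k) ((mpoly_deriv ^^ i) P) = (mpoly_deriv ^^ (i + k)) P" for i k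
      by (simp add: add.commute[of i k] funpow_add)
    then show ?thesis
      unfolding op_mult_def op_act_sum op_act_monom
      by (intro sum.cong refl)
         (simp add: higher_mpoly_deriv_mult matrix_mult_sum_right mat_mult_commute
           matrix_mul_assoc[symmetric])
  qed
  finally show ?thesis ..
qed

end

theory Submission
  imports Defs
begin

text \<open>
  The definition of a Darboux transformation is lopsided: \<open>\<V>\<close> maps the monic orthogonal
  polynomials \<open>P\<^sub>n\<close> of \<open>W\<close> to left multiples of the polynomials \<open>P'\<^sub>n\<close> of \<open>W'\<close>, while of
  \<open>\<N>\<close> it is only known that \<open>\<V>\<N>\<close> has the \<open>P\<^sub>n\<close> as eigenfunctions. The key is that the
  lopsidedness is illusory. As \<open>P\<^sub>n\<close> is monic, \<open>C P\<^sub>n \<noteq> 0\<close> for every constant matrix \<open>C \<noteq> 0\<close>; and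
  \<open>\<V>\<close>, which preserves degrees, annihilates only \<open>0\<close>. Hence in \<open>P\<^sub>n \<cdot> \<V> = A\<^sub>n P'\<^sub>n\<close> no \<open>C \<noteq> 0\<close>
  satisfies \<open>C A\<^sub>n = 0\<close>, so that \<open>A\<^sub>n\<close> is invertible, and
  \<open>P'\<^sub>n \<cdot> \<N> = A\<^sub>n\<^sup>-\<^sup>1 P\<^sub>n \<cdot> \<V>\<N> = A\<^sub>n\<^sup>-\<^sup>1 \<Lambda>\<^sub>n P\<^sub>n\<close>. So \<open>W'\<close> is a Darboux transformation of \<open>W\<close>
  if and only if there are degree-preserving operators that send the \<open>P\<^sub>n\<close> to left multiples of
  the \<open>P'\<^sub>n\<close> and vice versa (\<open>is_Darboux_transformation_iff\<close>). In this form symmetry is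
  evident, reflexivity is witnessed by the identity operator, and transitivity by the products
  \<open>\<V>\<^sub>1\<V>\<^sub>2\<close> and \<open>\<N>\<^sub>2\<N>\<^sub>1\<close>.

  The argument uses that \<open>P\<^sub>n\<close> is monic of degree \<open>n\<close>. Since \<open>monic_OPs\<close> is a definite description,
  this needs the existence and uniqueness of the monic orthogonal polynomials
  (\<open>monic_monic_OPs\<close>). They follow by Gram-Schmidt orthogonalization from the definiteness of the
  matrix-valued form \<open>\<integral> P W Q\<^sup>*\<close>: if \<open>\<integral> P W P\<^sup>* = 0\<close>, then each row of \<open>P\<close> vanishes almost
  everywhere on the interval, because \<open>W\<close> is positive definite almost everywhere, and a
  polynomial with infinitely many zeros is zero.
\<close>

section \<open>Matrix polynomials\<close>

lemma mpoly_coeff_const_mult: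
  "mpoly_coeff (mpoly_const C ** P) k = C ** mpoly_coeff P k"
  by (simp add: mpoly_coeff_def mpoly_const_def vec_eq_iff matrix_matrix_mult_def coeff_sum)

lemma mpoly_coeff_add: "mpoly_coeff (P + Q) k = mpoly_coeff P k + mpoly_coeff Q k"
  and mpoly_coeff_diff: "mpoly_coeff (P - Q) k = mpoly_coeff P k - mpoly_coeff Q k"
  and mpoly_coeff_0: "mpoly_coeff 0 k = 0"
  by (simp_all add: mpoly_coeff_def vec_eq_iff)

lemma mpoly_eqI: "(\<And>k. mpoly_coeff P k = mpoly_coeff Q k) \<Longrightarrow> P = Q"
  by (simp add: mpoly_coeff_def vec_eq_iff poly_eq_iff)

lemma mpoly_const_mult: "mpoly_const (A ** B) = mpoly_const A ** mpoly_const B"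
  by (simp add: mpoly_const_def vec_eq_iff matrix_matrix_mult_def poly_eq_iff coeff_sum
      coeff_pCons mult.commute split: nat.split)

lemma mpoly_const_mat_1: "mpoly_const (mat 1) = mat 1"
  by (simp add: mpoly_const_def vec_eq_iff mat_def one_pCons)

lemma mpoly_const_0: "mpoly_const 0 = 0"
  by (simp add: mpoly_const_def vec_eq_iff)

lemma mpoly_eval_add: "mpoly_eval (P + Q) x = mpoly_eval P x + mpoly_eval Q x"
  by (simp add: mpoly_eval_def vec_eq_iff)

lemma mpoly_eval_const_mult: "mpoly_eval (mpoly_const C ** P) x = C ** mpoly_eval P x"
  by (simp add: mpoly_eval_def mpoly_const_def vec_eq_iff matrix_matrix_mult_def poly_sum)

lemma mpoly_coeff_bound:
  obtains d where "\<And>k. k > d \<Longrightarrow> mpoly_coeff P k = 0"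
    and "\<And>x. mpoly_eval P x = (\<Sum>k\<le>d. x ^ k *\<^sub>R mpoly_coeff P k)"
proof
  define d where "d = Max (range (\<lambda>(i, j). degree (P $ i $ j)))"
  have d: "degree (P $ i $ j) \<le> d" for i j
    unfolding d_def by (rule Max_ge) auto
  show "mpoly_coeff P k = 0" if "k > d" for k
    using d that by (auto simp: mpoly_coeff_def vec_eq_iff intro!: coeff_eq_0 le_less_trans[OF d])
  have "poly (P $ i $ j) (of_real x) = (\<Sum>k\<le>d. x ^ k *\<^sub>R coeff (P $ i $ j) k)" for i j x
  proof -
    have "poly (P $ i $ j) (of_real x) =
        (\<Sum>k\<le>degree (P $ i $ j). coeff (P $ i $ j) k * complex_of_real x ^ k)"
      by (rule poly_altdef)
    also have "\<dots> = (\<Sum>k\<le>d. coeff (P $ i $ j) k * complex_of_real x ^ k)"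
      by (rule sum.mono_neutral_left) (use d in \<open>auto simp: coeff_eq_0\<close>)
    finally show ?thesis
      by (simp add: scaleR_conv_of_real mult.commute)
  qed
  then show "mpoly_eval P x = (\<Sum>k\<le>d. x ^ k *\<^sub>R mpoly_coeff P k)" for x
    by (simp add: mpoly_eval_def vec_eq_iff mpoly_coeff_def)
qed

text \<open>Degrees are compared with natural numbers through \<open>deg_less\<close>, which treats the zero
  polynomial uniformly: \<open>deg_less 0\<close> holds for it alone, and it is the start of the inductions on
  degrees.\<close>

definition deg_less :: "nat \<Rightarrow> 'n::finite mpoly \<Rightarrow> bool" where
  "deg_less n P \<longleftrightarrow> (\<forall>k\<ge>n. mpoly_coeff P k = 0)"

definition monic :: "nat \<Rightarrow> 'n::finite mpoly \<Rightarrow> bool" where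
  "monic n P \<longleftrightarrow> deg_less (Suc n) P \<and> mpoly_coeff P n = mat 1"

lemma mat_1_neq_0: "(mat 1 :: complex^'n^'n) \<noteq> 0"
  by (simp add: vec_eq_iff mat_def)

lemma monic_iff_degree:
  "monic n P \<longleftrightarrow> mpoly_degree P = ereal (real n) \<and> mpoly_coeff P n = mat 1"
proof (cases "mpoly_coeff P n = mat 1")
  case True
  let ?S = "{k. mpoly_coeff P k \<noteq> 0}"
  obtain d where "\<And>k. k > d \<Longrightarrow> mpoly_coeff P k = 0"
    using mpoly_coeff_bound[of P] by metis
  then have "?S \<subseteq> {..d}" by (metis (mono_tags) atMost_iff mem_Collect_eq not_le subsetI)
  then have fin: "finite ?S" by (rule finite_subset) simp
  have n: "n \<in> ?S" using True mat_1_neq_0 by simp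
  then have "P \<noteq> 0" by (auto simp: mpoly_coeff_0)
  then have "mpoly_degree P = ereal (real n) \<longleftrightarrow> Max ?S = n"
    by (simp add: mpoly_degree_def)
  also have "\<dots> \<longleftrightarrow> (\<forall>k\<in>?S. k \<le> n)"
    using Max_eq_iff[OF fin, of n] n by blast
  also have "\<dots> \<longleftrightarrow> deg_less (Suc n) P"
    unfolding deg_less_def by (auto simp: Suc_le_eq not_le[symmetric])
  finally show ?thesis using True by (simp add: monic_def)
qed (simp add: monic_def)

lemma monic_monom: "monic n (mat (monom 1 n))"
  by (auto simp: monic_def deg_less_def mpoly_coeff_def vec_eq_iff mat_def)

lemma deg_less_0_iff: "deg_less 0 P \<longleftrightarrow> P = 0"
  by (auto simp: deg_less_def mpoly_coeff_0 intro: mpoly_eqI)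

lemma deg_less_mono: "deg_less m P \<Longrightarrow> m \<le> n \<Longrightarrow> deg_less n P"
  by (auto simp: deg_less_def)

lemma deg_less_add: "deg_less n P \<Longrightarrow> deg_less n Q \<Longrightarrow> deg_less n (P + Q)"
  by (simp add: deg_less_def mpoly_coeff_add)

lemma deg_less_const_mult: "deg_less n P \<Longrightarrow> deg_less n (mpoly_const C ** P)"
  by (simp add: deg_less_def mpoly_coeff_const_mult)

lemma deg_less_monic_diff:
  assumes "monic n P" "monic n Q"
  shows "deg_less n (P - Q)"
  unfolding deg_less_def
proof (intro allI impI)
  fix k assume "n \<le> k"
  then show "mpoly_coeff (P - Q) k = 0"
    using assms by (cases "k = n") (auto simp: monic_def deg_less_def mpoly_coeff_diff)
qed

lemma monic_diff_deg_less:
  assumes "monic n P" "deg_less n R"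
  shows "monic n (P - R)"
  using assms by (auto simp: monic_def deg_less_def mpoly_coeff_diff)

text \<open>The induction step from degree less than \<open>n\<close> to degree at most \<open>n\<close>: subtracting the right
  left multiple of a monic polynomial of degree \<open>n\<close> removes the leading term.\<close>

lemma deg_less_Suc_split:
  assumes "monic n P" "deg_less (Suc n) T"
  obtains C S where "deg_less n S" "T = S + mpoly_const C ** P"
proof
  let ?C = "mpoly_coeff T n"
  show "deg_less n (T - mpoly_const ?C ** P)"
    unfolding deg_less_def
  proof (intro allI impI)
    fix k assume "n \<le> k"
    then show "mpoly_coeff (T - mpoly_const ?C ** P) k = 0"
      using assms
      by (cases "k = n")
         (auto simp: monic_def deg_less_def mpoly_coeff_diff mpoly_coeff_const_mult)
  qed
qed simp

lemma const_mult_monic_eq_0: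
  assumes "monic n P" "mpoly_const C ** P = 0"
  shows "C = 0"
  using assms mpoly_coeff_const_mult[of C P n] by (simp add: monic_def mpoly_coeff_0)

text \<open>If \<open>x\<^sup>T M = 0\<close> for a vector \<open>x\<close>, then the matrix with all rows equal to \<open>x\<^sup>T\<close> annihilates \<open>M\<close>,
  so triviality of the matrices \<open>C\<close> with \<open>C M = 0\<close> forces the transpose of \<open>M\<close> to have trivial
  kernel.\<close>

lemma invertible_if_no_left_annihilator:
  fixes M :: "complex^'n^'n"
  assumes "\<And>C :: complex^'n^'n. C ** M = 0 \<Longrightarrow> C = 0"
  shows "invertible M"
proof -
  have "x = 0" if "transpose M *v x = 0" for x
  proof -
    have "(\<chi> i. x) ** M = 0"
      using that
      by (simp add: vec_eq_iff matrix_matrix_mult_def matrix_vector_mult_def transpose_def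
          mult.commute)
    then have "(\<chi> i. x) = (0 :: complex^'n^'n)" by (rule assms)
    then show "x = 0" by (simp add: vec_eq_iff)
  qed
  then have "\<exists>B. B ** transpose M = mat 1"
    by (simp add: matrix_left_invertible_ker)
  then show ?thesis
    by (simp add: left_invertible_transpose invertible_right_inverse)
qed


section \<open>Orthogonalization\<close>

lemma conj_transpose_0: "conj_transpose 0 = 0"
  by (simp add: conj_transpose_def vec_eq_iff)

lemma conj_transpose_add: "conj_transpose (A + B) = conj_transpose A + conj_transpose B"
  by (simp add: conj_transpose_def vec_eq_iff)

lemma conj_transpose_scaleR: "conj_transpose (r *\<^sub>R A) = r *\<^sub>R conj_transpose A"
  by (simp add: conj_transpose_def vec_eq_iff)

lemma conj_transpose_mult: "conj_transpose (A ** B) = conj_transpose B ** conj_transpose A"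
  by (simp add: conj_transpose_def vec_eq_iff matrix_matrix_mult_def mult.commute)

lemma conj_transpose_conj_transpose: "conj_transpose (conj_transpose A) = A"
  by (simp add: conj_transpose_def vec_eq_iff)

text \<open>These are the properties of \<open>\<langle>P, Q\<rangle> = \<integral> P W Q\<^sup>*\<close> on which orthogonalization rests. Definiteness
  is required in the weak form that \<open>\<langle>P, P\<rangle> = 0\<close> implies \<open>P = 0\<close>, which still makes
  \<open>\<langle>P, P\<rangle>\<close> invertible for monic \<open>P\<close> (\<open>invertible_form_monic\<close>).\<close>

locale definite_matrix_form =
  fixes form :: "'n::finite mpoly \<Rightarrow> 'n mpoly \<Rightarrow> complex^'n^'n"
  assumes form_add_left: "form (P + P') Q = form P Q + form P' Q"
    and form_const_left: "form (mpoly_const C ** P) Q = C ** form P Q"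
    and form_commute: "form Q P = conj_transpose (form P Q)"
    and form_definite: "form P P = 0 \<Longrightarrow> P = 0"
begin

lemma form_add_right: "form P (Q + Q') = form P Q + form P Q'"
  by (simp add: form_commute[of P] form_add_left conj_transpose_add)

lemma form_const_right: "form P (mpoly_const C ** Q) = form P Q ** conj_transpose C"
  by (metis form_commute form_const_left conj_transpose_mult)

lemma form_0_left: "form 0 Q = 0"
  using form_add_left[of 0 0 Q] by simp

lemma form_0_right: "form P 0 = 0"
  by (simp add: form_commute[of P] form_0_left conj_transpose_0)

lemma form_diff_left: "form (P - P') Q = form P Q - form P' Q"
  using form_add_left[of "P - P'" P' Q] by (simp add: algebra_simps)

lemma form_zero_commute: "form P Q = 0 \<Longrightarrow> form Q P = 0"
  by (metis form_commute conj_transpose_0)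

text \<open>From \<open>C \<langle>P, P\<rangle> = 0\<close> it follows that \<open>\<langle>C P, C P\<rangle> = C \<langle>P, P\<rangle> C\<^sup>* = 0\<close>, hence \<open>C P = 0\<close>, whose
  leading coefficient is \<open>C\<close>.\<close>

lemma invertible_form_monic:
  assumes "monic n P"
  shows "invertible (form P P)"
proof (rule invertible_if_no_left_annihilator)
  fix C :: "complex^'n^'n" assume "C ** form P P = 0"
  then have "form (mpoly_const C ** P) (mpoly_const C ** P) = 0"
    by (simp add: form_const_left form_const_right matrix_mul_assoc)
  then show "C = 0"
    by (rule const_mult_monic_eq_0[OF assms form_definite])
qed

text \<open>Gram-Schmidt, phrased for the projection \<open>R\<close> of an arbitrary \<open>Q\<close> onto the polynomials of degree
  less than \<open>n\<close>: applied to \<open>x\<^sup>n\<close>, the induction hypothesis itself provides the next monic orthogonal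
  polynomial, so that no sums over earlier ones are needed.\<close>

lemma orthogonal_projection:
  "\<exists>R. deg_less n R \<and> (\<forall>T. deg_less n T \<longrightarrow> form (Q - R) T = 0)"
proof (induction n arbitrary: Q)
  case 0
  show ?case by (rule exI[of _ 0]) (auto simp: deg_less_0_iff form_0_right)
next
  case (Suc n)
  obtain R0 where R0: "deg_less n R0" "\<And>T. deg_less n T \<Longrightarrow> form (Q - R0) T = 0"
    using Suc by blast
  obtain X where X: "deg_less n X" "\<And>T. deg_less n T \<Longrightarrow> form (mat (monom 1 n) - X) T = 0"
    using Suc by blast
  define P where "P = mat (monom 1 n) - X"
  have P: "monic n P" "\<And>T. deg_less n T \<Longrightarrow> form P T = 0"
    using X monic_diff_deg_less[OF monic_monom] by (auto simp: P_def)
  obtain K where K: "K ** form P P = mat 1"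
    using invertible_form_monic[OF P(1)] invertible_left_inverse by blast
  \<comment> \<open>The Fourier coefficient along \<open>P\<close> of what remains of \<open>Q\<close>. Subtracting the multiple of \<open>P\<close> does not
    disturb the orthogonality to lower degrees, as \<open>P\<close> is itself orthogonal to them.\<close>
  define C where "C = form (Q - R0) P ** K"
  define R where "R = R0 + mpoly_const C ** P"
  have R_P: "form (Q - R) P = 0"
  proof -
    have "form (Q - R) P = form (Q - R0) P - C ** form P P"
      by (simp add: R_def diff_diff_eq[symmetric] form_diff_left form_const_left)
    also have "C ** form P P = form (Q - R0) P"
      by (simp add: C_def matrix_mul_assoc[symmetric] K)
    finally show ?thesis by simp
  qed
  have R_low: "form (Q - R) S = 0" if "deg_less n S" for S
    by (simp add: R_def diff_diff_eq[symmetric] form_diff_left[of _ "mpoly_const C ** P"]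
        form_const_left R0(2)[OF that] P(2)[OF that])
  have "form (Q - R) T = 0" if "deg_less (Suc n) T" for T
    using deg_less_Suc_split[OF P(1) that]
    by (metis R_P R_low add.right_neutral form_add_right form_const_right times0_left)
  moreover have "deg_less (Suc n) R"
    using R0(1) P(1) unfolding R_def monic_def
    by (intro deg_less_add deg_less_const_mult) (auto intro: deg_less_mono)
  ultimately show ?case by blast
qed

text \<open>Polynomials of degree less than \<open>m\<close> are combinations of \<open>P\<^sub>0, \<dots>, P\<^sub>m\<^sub>-\<^sub>1\<close> with matrix coefficients
  on the left. The separate bound \<open>m\<close> lets \<open>n\<close> stay fixed in the induction.\<close>

lemma monic_orthogonal_sequence_low_degree:
  assumes "\<And>n. monic n (P n)" "\<And>n m. n \<noteq> m \<Longrightarrow> form (P n) (P m) = 0"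
    and "m \<le> n" "deg_less m T"
  shows "form (P n) T = 0"
  using assms(3,4)
proof (induction m arbitrary: T)
  case 0
  then show ?case by (simp add: deg_less_0_iff form_0_right)
next
  case (Suc m)
  obtain C S where "deg_less m S" "T = S + mpoly_const C ** P m"
    using deg_less_Suc_split[OF assms(1) Suc.prems(2)] by blast
  then show ?case
    using Suc.IH[of S] Suc.prems(1) assms(2)[of n m]
    by (simp add: form_add_right form_const_right)
qed

text \<open>For uniqueness, the difference of two candidates of degree \<open>n\<close> has degree less than \<open>n\<close>, so both
  are orthogonal to it; therefore it is orthogonal to itself.\<close>

theorem ex1_monic_orthogonal_sequence:
  "\<exists>!P. (\<forall>n. monic n (P n)) \<and> (\<forall>n m. n \<noteq> m \<longrightarrow> form (P n) (P m) = 0)"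
proof (rule ex_ex1I)
  have "\<forall>n. \<exists>R. deg_less n R \<and> (\<forall>T. deg_less n T \<longrightarrow> form (mat (monom 1 n) - R) T = 0)"
    by (rule allI) (rule orthogonal_projection)
  then have "\<exists>R. \<forall>n. deg_less n (R n) \<and> (\<forall>T. deg_less n T \<longrightarrow> form (mat (monom 1 n) - R n) T = 0)"
    by (rule choice)
  then obtain R where R: "\<And>n. deg_less n (R n)"
      "\<And>n T. deg_less n T \<Longrightarrow> form (mat (monom 1 n) - R n) T = 0"
    by blast
  define P where "P n = mat (monom 1 n) - R n" for n
  have P: "monic n (P n)" for n
    unfolding P_def by (intro monic_diff_deg_less monic_monom R)
  have less: "form (P n) (P m) = 0" if "m < n" for n m
  proof -
    have "deg_less n (P m)"
      using deg_less_mono[of "Suc m" "P m" n] P[of m] that by (simp add: monic_def)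
    then show ?thesis unfolding P_def[of n] by (rule R(2))
  qed
  have "form (P n) (P m) = 0" if "n \<noteq> m" for n m
    using less[of m n] less[of n m] form_zero_commute that by (meson linorder_neqE_nat)
  with P show "\<exists>P. (\<forall>n. monic n (P n)) \<and> (\<forall>n m. n \<noteq> m \<longrightarrow> form (P n) (P m) = 0)"
    by blast
next
  fix P Q
  assume P: "(\<forall>n. monic n (P n)) \<and> (\<forall>n m. n \<noteq> m \<longrightarrow> form (P n) (P m) = 0)"
    and Q: "(\<forall>n. monic n (Q n)) \<and> (\<forall>n m. n \<noteq> m \<longrightarrow> form (Q n) (Q m) = 0)"
  show "P = Q"
  proof
    fix n
    have d: "deg_less n (P n - Q n)"
      using P Q by (intro deg_less_monic_diff) auto
    have "form (P n) (P n - Q n) = 0"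
      by (rule monic_orthogonal_sequence_low_degree[OF _ _ order_refl d]) (use P in auto)
    moreover have "form (Q n) (P n - Q n) = 0"
      by (rule monic_orthogonal_sequence_low_degree[OF _ _ order_refl d]) (use Q in auto)
    ultimately have "form (P n - Q n) (P n - Q n) = 0"
      by (simp add: form_diff_left)
    then have "P n - Q n = 0" by (rule form_definite)
    then show "P n = Q n" by simp
  qed
qed

end


section \<open>The inner product of a weight matrix\<close>

definition weight_form ::
    "ereal \<Rightarrow> ereal \<Rightarrow> (real \<Rightarrow> complex^'n^'n) \<Rightarrow> 'n mpoly \<Rightarrow> 'n mpoly \<Rightarrow> complex^'n^'n" where
  "weight_form a b W P Q =
     (LINT x:einterval a b|lborel. mpoly_eval P x ** W x ** conj_transpose (mpoly_eval Q x))"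

lemma matrix_add_rdistrib: "(A + B) ** C = A ** C + B ** C"
  by (simp add: vec_eq_iff matrix_matrix_mult_def distrib_right sum.distrib)

lemma bounded_linear_matrix_mult:
  fixes A B :: "complex^'n^'n"
  shows "bounded_linear (\<lambda>M. A ** M ** B)"
  unfolding linear_conv_bounded_linear[symmetric]
  by (rule linearI)
     (simp_all add: matrix_add_ldistrib matrix_add_rdistrib matrix_scalar_ac scalar_matrix_assoc[symmetric])

lemma bounded_linear_conj_transpose: "bounded_linear (conj_transpose :: complex^'n^'n \<Rightarrow> _)"
  unfolding linear_conv_bounded_linear[symmetric]
  by (rule linearI) (simp_all add: conj_transpose_add conj_transpose_scaleR)

lemma set_integral_bounded_linear:
  fixes f :: "_ \<Rightarrow> 'a::{banach, second_countable_topology}"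
    and T :: "'a \<Rightarrow> 'b::{banach, second_countable_topology}"
  assumes "bounded_linear T" "set_integrable M S f"
  shows "(LINT x:S|M. T (f x)) = T (LINT x:S|M. f x)"
    and "set_integrable M S (\<lambda>x. T (f x))"
proof -
  have *: "indicator S x *\<^sub>R T (f x) = T (indicator S x *\<^sub>R f x)" for x
    by (simp add: assms(1) linear_simps)
  show "(LINT x:S|M. T (f x)) = T (LINT x:S|M. f x)"
    using integral_bounded_linear[OF assms(1), of M "\<lambda>x. indicator S x *\<^sub>R f x"] assms(2)
    by (simp add: set_lebesgue_integral_def set_integrable_def *)
  show "set_integrable M S (\<lambda>x. T (f x))"
    using integrable_bounded_linear[OF assms(1), of M "\<lambda>x. indicator S x *\<^sub>R f x"] assms(2)
    by (simp add: set_integrable_def *)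
qed

text \<open>With \<open>r k = x\<^sup>k\<close> and \<open>s l = x\<^sup>l\<close> this expands \<open>P(x) W(x) Q(x)\<^sup>*\<close> into images of
  \<open>x\<^sup>k\<^sup>+\<^sup>l W(x)\<close> under fixed linear maps, which are integrable because \<open>W\<close> has finite moments.\<close>

lemma sum_matrix_mult_sum_conj:
  fixes M :: "complex^'n^'n" and A B :: "_ \<Rightarrow> complex^'n^'n"
  shows "(\<Sum>k\<in>S. r k *\<^sub>R A k) ** M ** conj_transpose (\<Sum>l\<in>T. s l *\<^sub>R B l) =
    (\<Sum>k\<in>S. \<Sum>l\<in>T. A k ** ((r k * s l) *\<^sub>R M) ** conj_transpose (B l))"
proof -
  have "conj_transpose (\<Sum>l\<in>T. s l *\<^sub>R B l) = (\<Sum>l\<in>T. s l *\<^sub>R conj_transpose (B l))"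
    using bounded_linear.linear[OF bounded_linear_conj_transpose, THEN linear_sum, of "\<lambda>l. s l *\<^sub>R B l" T]
    by (simp add: conj_transpose_scaleR)
  then show ?thesis
    by (simp add: matrix_mult_sum_right matrix_mult_sum_left matrix_scalar_ac
        scalar_matrix_assoc[symmetric] scaleR_sum_right mult.commute)
      (rule sum.swap)
qed

lemma weight_form_integrable:
  fixes W :: "real \<Rightarrow> complex^'n^'n"
  assumes "has_finite_moments a b W"
  shows "set_integrable lborel (einterval a b)
    (\<lambda>x. mpoly_eval P x ** W x ** conj_transpose (mpoly_eval Q x))"
proof -
  obtain d where d: "\<And>x. mpoly_eval P x = (\<Sum>k\<le>d. x ^ k *\<^sub>R mpoly_coeff P k)"
    using mpoly_coeff_bound[of P] by metis
  obtain e where e: "\<And>x. mpoly_eval Q x = (\<Sum>k\<le>e. x ^ k *\<^sub>R mpoly_coeff Q k)"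
    using mpoly_coeff_bound[of Q] by metis
  have int: "set_integrable lborel (einterval a b)
      (\<lambda>x. mpoly_coeff P k ** ((x ^ k * x ^ l) *\<^sub>R W x) ** conj_transpose (mpoly_coeff Q l))"
    for k l
    using assms
    by (intro set_integral_bounded_linear(2)[OF bounded_linear_matrix_mult])
       (simp add: has_finite_moments_def power_add[symmetric])
  show ?thesis
    unfolding d e sum_matrix_mult_sum_conj set_integrable_def scaleR_sum_right
    by (intro Bochner_Integration.integrable_sum int[unfolded set_integrable_def])
qed

text \<open>A nonzero \<open>p\<close> has finitely many roots, so the interval would be a null set, which a nonempty
  open set is not.\<close>

lemma poly_eq_0_if_AE:
  assumes "a < b" "AE x in lborel. x \<in> einterval a b \<longrightarrow> poly p (complex_of_real x) = 0"
  shows "p = 0"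
proof (rule ccontr)
  assume "p \<noteq> 0"
  then have "finite {z. poly p z = 0}" by (rule poly_roots_finite)
  then have "finite (complex_of_real -` {z. poly p z = 0})"
    by (rule finite_vimageI) (simp add: inj_of_real)
  then have "AE x in lborel. x \<notin> complex_of_real -` {z. poly p z = 0}"
    by (intro AE_not_in finite_imp_null_set_lborel)
  with assms(2) have "AE x in lborel. x \<notin> einterval a b"
    by eventually_elim auto
  then have "einterval a b \<in> null_sets lborel"
    by (subst AE_iff_null_sets) auto
  then have "negligible (einterval a b)"
    by (simp add: negligible_iff_null_sets null_sets_completionI)
  moreover obtain c where "a < ereal c" "ereal c < b"
    using ereal_dense2[OF assms(1)] by blast
  then have "c \<in> einterval a b" by (simp add: einterval_iff)
  ultimately show False using open_not_negligible[of "einterval a b"] by auto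
qed

text \<open>The \<open>i\<close>-th diagonal entry of \<open>P W P\<^sup>*\<close> is the quadratic form of \<open>W\<close> at the conjugate of the \<open>i\<close>-th
  row of \<open>P\<close>: almost everywhere it is nonnegative, and positive unless the row vanishes. Its integral being
  zero, the row is zero almost everywhere.\<close>

lemma weight_form_definite:
  fixes W :: "real \<Rightarrow> complex^'n^'n"
  assumes "a < b" "W \<in> weight_matrices a b" "weight_form a b W P P = 0"
  shows "P = 0"
proof -
  let ?I = "einterval a b"
  have mom: "has_finite_moments a b W"
    and pos: "AE x in lborel. x \<in> ?I \<longrightarrow> pos_definite (W x)"
    using assms(2) by (auto simp: weight_matrices_def)
  have "P $ i $ j = 0" for i j
  proof -
    let ?F = "\<lambda>x. mpoly_eval P x ** W x ** conj_transpose (mpoly_eval P x)"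
    let ?v = "\<lambda>x. (\<chi> k. cnj (poly (P $ i $ k) (complex_of_real x)))"
    let ?g = "\<lambda>x. Re (?F x $ i $ i)"
    have bl: "bounded_linear (\<lambda>M. Re (M $ i $ i))" for M :: "complex^'n^'n"
      by (intro bounded_linear_intros bounded_linear_compose[OF bounded_linear_Re]
          bounded_linear_compose[OF bounded_linear_vec_nth])
    have g: "?g x = Re (\<Sum>k\<in>UNIV. \<Sum>l\<in>UNIV. cnj (?v x $ k) * W x $ k $ l * ?v x $ l)" for x
      by (simp add: matrix_matrix_mult_def mpoly_eval_def conj_transpose_def sum_distrib_right)
         (subst sum.swap, simp)
    have zero: "(LINT x:?I|lborel. ?g x) = 0" and int: "set_integrable lborel ?I ?g"
      using set_integral_bounded_linear[OF bl weight_form_integrable[OF mom, of P P]] assms(3)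
      by (simp_all add: weight_form_def)
    have pos_g: "AE x in lborel. x \<in> ?I \<longrightarrow> ?v x \<noteq> 0 \<longrightarrow> 0 < ?g x"
      using pos by eventually_elim (unfold g pos_definite_def, blast)
    have "AE x in lborel. 0 \<le> indicator ?I x *\<^sub>R ?g x"
      using pos_g
    proof eventually_elim
      case (elim x)
      show ?case
      proof (cases "?v x = 0")
        case True
        have "?g x = 0" unfolding g True by simp
        then show ?thesis by simp
      qed (use elim in \<open>auto simp: indicator_def\<close>)
    qed
    then have "AE x in lborel. indicator ?I x *\<^sub>R ?g x = 0"
      using zero int integral_nonneg_eq_0_iff_AE
      unfolding set_integrable_def set_lebesgue_integral_def by blast
    with pos_g have "AE x in lborel. x \<in> ?I \<longrightarrow> poly (P $ i $ j) (complex_of_real x) = 0"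
    proof eventually_elim
      case (elim x)
      show ?case
      proof
        assume "x \<in> ?I"
        with elim have "?v x = 0" by fastforce
        then show "poly (P $ i $ j) (complex_of_real x) = 0"
          by (simp add: vec_eq_iff)
      qed
    qed
    then show ?thesis by (rule poly_eq_0_if_AE[OF assms(1)])
  qed
  then show ?thesis by (simp add: vec_eq_iff)
qed

lemma weight_form_commute:
  fixes W :: "real \<Rightarrow> complex^'n^'n"
  assumes "W \<in> weight_matrices a b"
  shows "weight_form a b W Q P = conj_transpose (weight_form a b W P Q)"
proof -
  let ?F = "\<lambda>P Q x. mpoly_eval P x ** W x ** conj_transpose (mpoly_eval Q x)"
  have mom: "has_finite_moments a b W"
    and pos: "AE x in lborel. x \<in> einterval a b \<longrightarrow> pos_definite (W x)"
    using assms by (auto simp: weight_matrices_def)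
  note int = weight_form_integrable[OF mom]
  have "weight_form a b W Q P = (LINT x:einterval a b|lborel. conj_transpose (?F P Q x))"
    unfolding weight_form_def set_lebesgue_integral_def
  proof (rule integral_cong_AE)
    show "AE x in lborel. indicator (einterval a b) x *\<^sub>R ?F Q P x =
        indicator (einterval a b) x *\<^sub>R conj_transpose (?F P Q x)"
      using pos
      by eventually_elim
         (auto simp: conj_transpose_mult conj_transpose_conj_transpose pos_definite_def
           matrix_mul_assoc indicator_def)
  qed (use int set_integral_bounded_linear(2)[OF bounded_linear_conj_transpose int]
        in \<open>simp_all add: set_integrable_def borel_measurable_integrable\<close>)
  also have "\<dots> = conj_transpose (weight_form a b W P Q)"
    unfolding weight_form_def
    by (rule set_integral_bounded_linear(1)[OF bounded_linear_conj_transpose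
          weight_form_integrable[OF mom]])
  finally show ?thesis .
qed

lemma weight_form_definite_matrix_form:
  fixes W :: "real \<Rightarrow> complex^'n^'n"
  assumes "a < b" "W \<in> weight_matrices a b"
  shows "definite_matrix_form (weight_form a b W)"
proof
  have mom: "has_finite_moments a b W"
    using assms by (auto simp: weight_matrices_def)
  show "weight_form a b W (P + P') Q = weight_form a b W P Q + weight_form a b W P' Q" for P P' Q
    by (simp add: weight_form_def mpoly_eval_add matrix_add_rdistrib
        set_integral_add(2)[OF weight_form_integrable[OF mom] weight_form_integrable[OF mom]])
  show "weight_form a b W (mpoly_const C ** P) Q = C ** weight_form a b W P Q" for C P Q
    using set_integral_bounded_linear(1)[OF bounded_linear_matrix_mult[of C "mat 1"]
        weight_form_integrable[OF mom, of P Q]]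
    by (simp add: weight_form_def mpoly_eval_const_mult matrix_mul_assoc)
qed (use assms weight_form_commute weight_form_definite in blast)+

text \<open>The fact about \<open>monic_OPs\<close> that the theory of Darboux transformations needs: the definite
  description denotes a sequence of monic polynomials.\<close>

theorem monic_monic_OPs:
  fixes W :: "real \<Rightarrow> complex^'n^'n"
  assumes "a < b" "W \<in> weight_matrices a b"
  shows "monic n (monic_OPs a b W n)"
proof -
  interpret definite_matrix_form "weight_form a b W"
    by (rule weight_form_definite_matrix_form[OF assms])
  have "\<exists>!P. is_monic_OPs a b W P"
    using ex1_monic_orthogonal_sequence
    by (simp add: is_monic_OPs_def monic_iff_degree weight_form_def)
  then have "is_monic_OPs a b W (monic_OPs a b W)"
    unfolding monic_OPs_def by (rule theI')
  then show ?thesis by (simp add: is_monic_OPs_def monic_iff_degree)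
qed


section \<open>Darboux transformations\<close>

lemma mpoly_deriv_const_mult: "mpoly_deriv (mpoly_const C ** P) = mpoly_const C ** mpoly_deriv P"
proof -
  have "mpoly_deriv (mpoly_const C) = 0"
    by (simp add: mpoly_deriv_def mpoly_const_def vec_eq_iff pderiv_pCons)
  then show ?thesis by (simp add: mpoly_deriv_mult)
qed

lemma op_act_const_mult: "op_act (mpoly_const C ** P) D = mpoly_const C ** op_act P D"
proof -
  have "(mpoly_deriv ^^ j) (mpoly_const C ** P) = mpoly_const C ** (mpoly_deriv ^^ j) P" for j
    by (induction j) (simp_all add: mpoly_deriv_const_mult)
  then show ?thesis
    by (simp add: op_act_def matrix_mult_sum_left matrix_mul_assoc)
qed

lemma op_act_one: "op_act P (monom (mat 1) 0) = P"
  by (simp add: op_act_monom)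

lemma degree_preserving_one: "degree_preserving (monom (mat 1) 0)"
  by (simp add: degree_preserving_def op_act_one)

lemma degree_preserving_mult:
  "degree_preserving V \<Longrightarrow> degree_preserving N \<Longrightarrow> degree_preserving (op_mult V N)"
  by (simp add: degree_preserving_def op_act_op_mult)

lemma degree_preserving_eq_0:
  assumes "degree_preserving V" "op_act P V = 0"
  shows "P = 0"
proof -
  have "mpoly_degree P = -\<infinity>"
    using assms by (metis degree_preserving_def mpoly_degree_def)
  then show ?thesis by (auto simp: mpoly_degree_def split: if_splits)
qed

text \<open>If \<open>C A = 0\<close>, then \<open>(C P) \<cdot> V = C A Q = 0\<close>, and therefore \<open>C P = 0\<close>, because \<open>V\<close> preserves the
  degree \<open>-\<infinity>\<close>.\<close>

lemma invertible_if_degree_preserving: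
  fixes A :: "complex^'n^'n"
  assumes "degree_preserving V" "monic n P" "op_act P V = mpoly_const A ** Q"
  shows "invertible A"
proof (rule invertible_if_no_left_annihilator)
  fix C :: "complex^'n^'n" assume "C ** A = 0"
  then have "op_act (mpoly_const C ** P) V = 0"
    by (simp add: op_act_const_mult assms(3) matrix_mul_assoc mpoly_const_mult[symmetric]
        mpoly_const_0)
  then show "C = 0"
    by (rule const_mult_monic_eq_0[OF assms(2) degree_preserving_eq_0[OF assms(1)]])
qed

text \<open>Both conditions in the definition of a Darboux transformation are instances: \<open>D \<in> \<D>(W)\<close> is the
  case \<open>Q = P\<close>.\<close>

definition intertwines :: "'n::finite diff_op \<Rightarrow> (nat \<Rightarrow> 'n mpoly) \<Rightarrow> (nat \<Rightarrow> 'n mpoly) \<Rightarrow> bool" where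
  "intertwines V P Q \<longleftrightarrow> (\<exists>A. \<forall>n. op_act (P n) V = mpoly_const (A n) ** Q n)"

lemma intertwines_one: "intertwines (monom (mat 1) 0) P P"
  unfolding intertwines_def
  by (rule exI[of _ "\<lambda>_. mat 1"]) (simp add: op_act_one mpoly_const_mat_1)

lemma intertwines_mult:
  assumes "intertwines V P Q" "intertwines V' Q R"
  shows "intertwines (op_mult V V') P R"
proof -
  obtain A B where "\<And>n. op_act (P n) V = mpoly_const (A n) ** Q n"
    "\<And>n. op_act (Q n) V' = mpoly_const (B n) ** R n"
    using assms by (auto simp: intertwines_def)
  then have "op_act (P n) (op_mult V V') = mpoly_const (A n ** B n) ** R n" for n
    by (simp add: op_act_op_mult op_act_const_mult mpoly_const_mult matrix_mul_assoc)
  then show ?thesis unfolding intertwines_def by (intro exI[of _ "\<lambda>n. A n ** B n"]) simp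
qed

text \<open>The heart of the symmetry: by the invertibility of \<open>A\<^sub>n\<close> in \<open>P\<^sub>n \<cdot> V = A\<^sub>n Q\<^sub>n\<close>, the polynomial \<open>Q\<^sub>n\<close>
  is a left multiple of \<open>P\<^sub>n \<cdot> V\<close>, and \<open>N\<close> takes \<open>P\<^sub>n \<cdot> V\<close> back to a left multiple of \<open>P\<^sub>n\<close>.\<close>

lemma intertwines_right_factor:
  assumes "intertwines (op_mult V N) P P" "degree_preserving V" "intertwines V P Q"
    and "\<And>n. monic n (P n)"
  shows "intertwines N Q P"
proof -
  obtain \<Lambda> A where \<Lambda>: "\<And>n. op_act (P n) (op_mult V N) = mpoly_const (\<Lambda> n) ** P n"
    and A: "\<And>n. op_act (P n) V = mpoly_const (A n) ** Q n"
    using assms(1,3) by (auto simp: intertwines_def)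
  have "\<exists>K. K ** A n = mat 1" for n
    using invertible_if_degree_preserving[OF assms(2,4) A] invertible_left_inverse by blast
  then obtain K where K: "\<And>n. K n ** A n = mat 1" by metis
  have "op_act (Q n) N = mpoly_const (K n ** \<Lambda> n) ** P n" for n
  proof -
    have "Q n = mpoly_const (K n) ** op_act (P n) V"
      by (simp add: A matrix_mul_assoc mpoly_const_mult[symmetric] K mpoly_const_mat_1)
    then have "op_act (Q n) N = mpoly_const (K n) ** op_act (P n) (op_mult V N)"
      by (simp add: op_act_op_mult op_act_const_mult)
    then show ?thesis
      by (simp add: \<Lambda> mpoly_const_mult matrix_mul_assoc)
  qed
  then show ?thesis unfolding intertwines_def by (intro exI[of _ "\<lambda>n. K n ** \<Lambda> n"]) simp
qed

text \<open>The symmetric reformulation. Conversely to \<open>intertwines_right_factor\<close>, two operators that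
  intertwine in opposite directions have a product in \<open>\<D>(W)\<close>.\<close>

lemma is_Darboux_transformation_iff:
  fixes W W' :: "real \<Rightarrow> complex^'n^'n"
  assumes "a < b" "W \<in> weight_matrices a b"
  shows "is_Darboux_transformation a b W W' \<longleftrightarrow>
    (\<exists>V N. degree_preserving V \<and> degree_preserving N \<and>
       intertwines V (monic_OPs a b W) (monic_OPs a b W') \<and>
       intertwines N (monic_OPs a b W') (monic_OPs a b W))"
    (is "?L \<longleftrightarrow> ?R")
proof -
  let ?P = "monic_OPs a b W" and ?P' = "monic_OPs a b W'"
  have ops: "D \<in> weight_ops a b W \<longleftrightarrow> intertwines D ?P ?P" for D
    by (auto simp: weight_ops_def intertwines_def choice_iff)
  show ?thesis
  proof
    assume ?L
    then obtain V N where "intertwines (op_mult V N) ?P ?P" "degree_preserving V"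
      "degree_preserving N" "intertwines V ?P ?P'"
      unfolding is_Darboux_transformation_def Bex_def ops
        intertwines_def[of _ ?P ?P', symmetric] by blast
    then show ?R
      using intertwines_right_factor[OF _ _ _ monic_monic_OPs[OF assms]] by blast
  next
    assume ?R
    then show ?L
      unfolding is_Darboux_transformation_def Bex_def ops intertwines_def[of _ ?P ?P', symmetric]
      using intertwines_mult by blast
  qed
qed

theorem proposition3p5:
  fixes a b :: ereal
  assumes "a < b"
  shows "equiv (weight_matrices a b :: (real \<Rightarrow> complex^'n^'n) set)
           {(W, W'). W \<in> weight_matrices a b \<and> W' \<in> weight_matrices a b \<and>
                     is_Darboux_transformation a b W W'}"
proof (rule equivI)
  note iff = is_Darboux_transformation_iff[OF assms]
  let ?r = "{(W, W'). W \<in> weight_matrices a b \<and> W' \<in> weight_matrices a b \<and>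
                     is_Darboux_transformation a b W W'} :: (real \<Rightarrow> complex^'n^'n) rel"
  show "?r \<subseteq> weight_matrices a b \<times> weight_matrices a b" by auto
  show "refl_on (weight_matrices a b) ?r"
  proof (rule refl_onI)
    fix W :: "real \<Rightarrow> complex^'n^'n" assume W: "W \<in> weight_matrices a b"
    have "is_Darboux_transformation a b W W"
      unfolding iff[OF W] using degree_preserving_one intertwines_one by blast
    with W show "(W, W) \<in> ?r" by blast
  qed
  show "sym ?r"
  proof (rule symI)
    fix W W' assume "(W, W') \<in> ?r"
    then show "(W', W) \<in> ?r"
      using iff[of W W'] iff[of W' W] by blast
  qed
  show "trans ?r"
  proof (rule transI)
    fix W W' W'' assume WW': "(W, W') \<in> ?r" and W'W'': "(W', W'') \<in> ?r"
    obtain V\<^sub>1 N\<^sub>1 where 1: "degree_preserving V\<^sub>1" "degree_preserving N\<^sub>1"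
      "intertwines V\<^sub>1 (monic_OPs a b W) (monic_OPs a b W')"
      "intertwines N\<^sub>1 (monic_OPs a b W') (monic_OPs a b W)"
      using WW' iff[of W W'] by blast
    obtain V\<^sub>2 N\<^sub>2 where 2: "degree_preserving V\<^sub>2" "degree_preserving N\<^sub>2"
      "intertwines V\<^sub>2 (monic_OPs a b W') (monic_OPs a b W'')"
      "intertwines N\<^sub>2 (monic_OPs a b W'') (monic_OPs a b W')"
      using W'W'' iff[of W' W''] by blast
    have "degree_preserving (op_mult V\<^sub>1 V\<^sub>2)" "degree_preserving (op_mult N\<^sub>2 N\<^sub>1)"
      by (intro degree_preserving_mult 1 2)+
    moreover have "intertwines (op_mult V\<^sub>1 V\<^sub>2) (monic_OPs a b W) (monic_OPs a b W'')"
      by (rule intertwines_mult[OF 1(3) 2(3)])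
    moreover have "intertwines (op_mult N\<^sub>2 N\<^sub>1) (monic_OPs a b W'') (monic_OPs a b W)"
      by (rule intertwines_mult[OF 2(4) 1(4)])
    ultimately have "is_Darboux_transformation a b W W''"
      using WW' iff[of W W''] by blast
    then show "(W, W'') \<in> ?r" using WW' W'W'' by blast
  qed
qed

end
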